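(* Let $c,r$ be positive integers with $c+1<r<2c$, and let $n>\frac{r-c-1}{c}\binom{r}{2}+r-1$. Then $R^c(B^rK_n)\le \frac{c}{r-c-1}\,n$.
   Context: An $r$-uniform hypergraph ($r$-graph) consists of a vertex set and a set of $r$-element subsets of it (hyperedges); $\mathcal{K}_N^r$ denotes the complete $r$-graph on $N$ vertices and $K_n$ the complete graph on $n$ vertices. For a graph $F$, an $r$-graph $\mathcal{H}$ contains a Berge-$F$ if there are an injection $\varphi:V(F)\to V(\mathcal{H})$ and an injection $f$ from $E(F)$ to the hyperedges of $\mathcal{H}$ with $\{\varphi(x),\varphi(y)\}\subseteq f(xy)$ for every edge $xy$; $B^rF$ is the family of $r$-uniform Berge copies of $F$. A $c$-coloring assigns to each hyperedge one of the colors $1,\dots,c$. $R^c(B^rK_n)$ is the smallest $N$ such that in every $c$-coloring of $\mathcal{K}_N^r$ the hyperedges of some single color contain a Berge-$K_n$. *)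

theory Defs
  imports Complex_Main "HOL-Library.Ramsey"
begin

text \<open>A hypergraph is a pair of a vertex set and a set of hyperedges; a graph is the 2-uniform
  case.  The library constant \<open>nsets A r\<close> is the set of all \<open>r\<close>-element subsets of \<open>A\<close>.\<close>

type_synonym 'a hypergraph = "'a set \<times> 'a set set"

abbreviation verts :: "'a hypergraph \<Rightarrow> 'a set"
  where "verts \<equiv> fst"

abbreviation hyperedges :: "'a hypergraph \<Rightarrow> 'a set set"
  where "hyperedges \<equiv> snd"

definition complete_hypergraph :: "nat \<Rightarrow> nat \<Rightarrow> nat hypergraph"
  where "complete_hypergraph r N = ({..<N}, nsets {..<N} r)"

definition complete_graph :: "nat \<Rightarrow> nat hypergraph"
  where "complete_graph n = complete_hypergraph 2 n"

text \<open>For an edge \<open>e = {x, y}\<close>, the image \<open>\<phi> ` e\<close> is \<open>{\<phi> x, \<phi> y}\<close>.\<close>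

definition contains_Berge :: "'a hypergraph \<Rightarrow> 'b hypergraph \<Rightarrow> bool"
  where "contains_Berge H F \<longleftrightarrow>
    (\<exists>\<phi> f. inj_on \<phi> (verts F) \<and> \<phi> ` verts F \<subseteq> verts H \<and>
           inj_on f (hyperedges F) \<and> f ` hyperedges F \<subseteq> hyperedges H \<and>
           (\<forall>e\<in>hyperedges F. \<phi> ` e \<subseteq> f e))"

definition is_coloring :: "nat \<Rightarrow> 'a hypergraph \<Rightarrow> ('a set \<Rightarrow> nat) \<Rightarrow> bool"
  where "is_coloring c H \<chi> \<longleftrightarrow> \<chi> \<in> hyperedges H \<rightarrow> {1..c}"

definition color_class :: "'a hypergraph \<Rightarrow> ('a set \<Rightarrow> nat) \<Rightarrow> nat \<Rightarrow> 'a hypergraph"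
  where "color_class H \<chi> i = (verts H, {e \<in> hyperedges H. \<chi> e = i})"

definition forces_Berge :: "nat \<Rightarrow> nat \<Rightarrow> 'b hypergraph \<Rightarrow> nat \<Rightarrow> bool"
  where "forces_Berge c r F N \<longleftrightarrow>
    (\<forall>\<chi>. is_coloring c (complete_hypergraph r N) \<chi> \<longrightarrow>
         (\<exists>i\<in>{1..c}. contains_Berge (color_class (complete_hypergraph r N) \<chi> i) F))"

definition berge_ramsey :: "nat \<Rightarrow> nat \<Rightarrow> 'b hypergraph \<Rightarrow> nat"
  where "berge_ramsey c r F = (LEAST N. forces_Berge c r F N)"

text \<open>The minimum defining \<open>berge_ramsey c r (complete_graph n)\<close> is attained: by Ramsey's theorem
  some color contains a complete \<open>r\<close>-uniform hypergraph on \<open>n + (r - 2)\<close> vertices, and adding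
  \<open>r - 2\<close> fixed vertices to each edge of a complete graph on the other \<open>n\<close> vertices yields a
  Berge copy.\<close>

lemma contains_Berge_complete:
  assumes r: "2 \<le> r" and h: "inj_on h {..<n + (r - 2)}" "h ` {..<n + (r - 2)} \<subseteq> verts H"
    and E: "nsets (h ` {..<n + (r - 2)}) r \<subseteq> hyperedges H"
  shows "contains_Berge H (complete_graph n)"
proof -
  define f where "f e = h ` (e \<union> {n..<n + (r - 2)})" for e
  let ?M = "{..<n + (r - 2)}"
  have sub: "e \<union> {n..<n + (r - 2)} \<subseteq> ?M" if "e \<in> nsets {..<n} 2" for e
    using that by (auto simp: nsets_def)
  have crd: "card (e \<union> {n..<n + (r - 2)}) = r" if "e \<in> nsets {..<n} 2" for e
  proof -
    have "e \<inter> {n..<n + (r - 2)} = {}" using that by (auto simp: nsets_def)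
    then show ?thesis using that r by (simp add: nsets_def card_Un_disjoint)
  qed
  have "f e \<in> hyperedges H" if e: "e \<in> nsets {..<n} 2" for e
  proof -
    have "card (f e) = r"
      unfolding f_def using crd[OF e] sub[OF e] h(1) by (metis card_image inj_on_subset)
    moreover have "f e \<subseteq> h ` ?M" unfolding f_def using sub[OF e] by blast
    moreover have "finite (f e)" using e by (simp add: f_def nsets_def)
    ultimately show ?thesis using E by (auto simp: nsets_def)
  qed
  moreover have "inj_on f (nsets {..<n} 2)"
  proof (rule inj_onI)
    fix d e assume de: "d \<in> nsets {..<n} 2" "e \<in> nsets {..<n} 2" "f d = f e"
    then have "d \<union> {n..<n + (r - 2)} = e \<union> {n..<n + (r - 2)}"
      unfolding f_def using inj_on_image_eq_iff[OF h(1) sub sub] by blast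
    then have "(d \<union> {n..<n + (r - 2)}) \<inter> {..<n} = (e \<union> {n..<n + (r - 2)}) \<inter> {..<n}" by simp
    moreover have "(d \<union> {n..<n + (r - 2)}) \<inter> {..<n} = d"
      if "d \<in> nsets {..<n} 2" for d using that by (auto simp: nsets_def)
    ultimately show "d = e" using de by metis
  qed
  moreover have "inj_on h {..<n}" by (rule inj_on_subset[OF h(1)]) auto
  moreover have "h ` {..<n} \<subseteq> verts H" using h(2) by auto
  moreover have "\<forall>e\<in>nsets {..<n} 2. h ` e \<subseteq> f e" by (auto simp: f_def)
  ultimately show ?thesis
    unfolding contains_Berge_def complete_graph_def complete_hypergraph_def
    by (intro exI[of _ h] exI[of _ f]) auto
qed

lemma forces_Berge_complete_graph:
  assumes c: "1 \<le> c" and r: "2 \<le> r"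
  shows "\<exists>N. forces_Berge c r (complete_graph n) N"
proof -
  let ?m = "n + (r - 2)"
  obtain N :: nat where N: "partn_lst {..<N} (replicate c ?m) r"
    using ramsey_full by blast
  have "forces_Berge c r (complete_graph n) N"
    unfolding forces_Berge_def
  proof (intro allI impI)
    fix \<chi> assume "is_coloring c (complete_hypergraph r N) \<chi>"
    then have \<chi>: "\<chi> e \<in> {1..c}" if "e \<in> nsets {..<N} r" for e
      using that unfolding is_coloring_def complete_hypergraph_def snd_conv by (rule Pi_mem)
    have "(\<lambda>e. \<chi> e - 1) \<in> nsets {..<N} r \<rightarrow> {..<c}"
      using \<chi> by fastforce
    from partn_lstE[OF N this] obtain i S where i: "i < c"
      and S: "S \<in> nsets {..<N} ?m" and mono: "(\<lambda>e. \<chi> e - 1) ` nsets S r \<subseteq> {i}"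
      by (metis length_replicate nth_replicate)
    have fin: "finite S" "card S = ?m" and SN: "S \<subseteq> {..<N}" using S by (auto simp: nsets_def)
    obtain h where h: "bij_betw h {..<?m} S"
      using fin by (metis card_lessThan finite_lessThan finite_same_card_bij)
    have "\<chi> e = Suc i" if "e \<in> nsets S r" for e
    proof -
      have "e \<in> nsets {..<N} r" using that nsets_mono[OF SN] by blast
      from \<chi>[OF this] have "1 \<le> \<chi> e" by simp
      moreover have "\<chi> e - 1 = i" using mono that by blast
      ultimately show ?thesis by simp
    qed
    then have "nsets S r \<subseteq> hyperedges (color_class (complete_hypergraph r N) \<chi> (Suc i))"
      using nsets_mono[OF SN, of r] by (auto simp: color_class_def complete_hypergraph_def)
    then have "contains_Berge (color_class (complete_hypergraph r N) \<chi> (Suc i)) (complete_graph n)"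
      using contains_Berge_complete[OF r bij_betw_imp_inj_on[OF h]] SN bij_betw_imp_surj_on[OF h]
      by (simp add: color_class_def complete_hypergraph_def)
    then show "\<exists>i\<in>{1..c}. contains_Berge (color_class (complete_hypergraph r N) \<chi> i) (complete_graph n)"
      using i by (intro bexI[of _ "Suc i"]) auto
  qed
  then show ?thesis by blast
qed

end

theory Submission
  imports Defs
begin

text \<open>
  Call a pair light in color \<open>i\<close> if fewer than \<open>r choose 2\<close> hyperedges of color \<open>i\<close> contain it.  By
  Hall's theorem, \<open>n\<close> vertices without a pair that is light in color \<open>i\<close> span a Berge-\<open>K\<^sub>n\<close> of color
  \<open>i\<close>, so without a monochromatic Berge-\<open>K\<^sub>n\<close> the graph of light pairs of each color has
  independence number less than \<open>n\<close>.  A graph with \<open>a\<close> isolated vertices and \<open>b\<close> vertices of degree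
  1 has an independent set of size at least \<open>a + b/2\<close>.  With \<open>k = r - c - 1\<close> and
  \<open>N > c(n - 1)/k\<close>, averaging over the vertices yields a vertex \<open>v\<close> at which \<open>z\<close> colors have no
  light pair and \<open>o\<close> colors exactly one, where \<open>2z + o < 2k\<close>.

  Choose one light pair of each color, at \<open>v\<close> where possible.  Together with \<open>v\<close> these pairs cover
  at most \<open>1 + c + z \<le> r - 1\<close> vertices.  An \<open>(r - 2)\<close>-set containing a light pair of every color
  lies in too many hyperedges, since each of them contains a light pair of its own color.  Hence
  \<open>z = k - 1\<close>, \<open>o \<le> 1\<close>, and pairs of different colors are disjoint outside \<open>v\<close>.  All colors but at
  most one offer two choices of the pair, so there are \<open>2^(c - 1)\<close> different \<open>(r - 1)\<close>-sets, using only
  \<open>2c - 1\<close> light pairs; each of them extends to a hyperedge by any vertex outside all chosen pairs.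
  These are more hyperedges than the light pairs can carry.
\<close>

section \<open>Hall's theorem\<close>

lemma Hall_marriage:
  assumes "finite I" and "\<And>i. i \<in> I \<Longrightarrow> finite (S i)"
    and "\<And>J. J \<subseteq> I \<Longrightarrow> card J \<le> card (\<Union>(S ` J))"
  shows "\<exists>f. inj_on f I \<and> (\<forall>i\<in>I. f i \<in> S i)"
  using assms
proof (induction "card I" arbitrary: I S rule: less_induct)
  case less
  show ?case
  proof (cases "I = {}")
    case True
    then show ?thesis by simp
  next
    case False
    \<comment> \<open>Split on a tight set, a nonempty proper \<open>J\<close> whose sets cover
      exactly \<open>card J\<close> elements. If one exists, \<open>J\<close> and
      \<open>I - J\<close> are matched separately by induction.\<close>
    show ?thesis
    proof (cases "\<exists>J. J \<subset> I \<and> J \<noteq> {} \<and> card (\<Union>(S ` J)) = card J")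
      case True
      then obtain J where J: "J \<subset> I" "J \<noteq> {}" "card (\<Union>(S ` J)) = card J" by blast
      have finJ: "finite J" using J(1) less.prems(1) by (meson finite_subset psubset_imp_subset)
      have "card J < card I" using J(1) less.prems(1) by (simp add: psubset_card_mono)
      then obtain f where f: "inj_on f J" "\<forall>i\<in>J. f i \<in> S i"
        using less.hyps[of J S] finJ less.prems J(1) by (metis psubset_imp_subset subset_iff subset_trans)
      define W where "W = \<Union>(S ` J)"
      have finW: "finite W" unfolding W_def using finJ J(1) less.prems(2) by blast
      have "card (I - J) < card I"
        using J less.prems(1) by (intro psubset_card_mono) auto
      moreover have "card K \<le> card (\<Union>((\<lambda>i. S i - W) ` K))" if K: "K \<subseteq> I - J" for K
      proof -
        have finK: "finite K" using K less.prems(1) by (meson finite_Diff finite_subset)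
        have finU: "finite (\<Union>(S ` (K \<union> J)))"
          using finK finJ K J(1) less.prems(2) by blast
        \<comment> \<open>Hall's condition for \<open>K \<union> J\<close>, minus the equality for
          \<open>J\<close>, leaves Hall's condition for \<open>K\<close> after the removal of
          \<open>W\<close>.\<close>
        have "card K + card J = card (K \<union> J)"
          using K finK finJ by (subst card_Un_disjoint) auto
        also have "\<dots> \<le> card (\<Union>(S ` (K \<union> J)))"
          using less.prems(3) K J(1) by blast
        also have "\<Union>(S ` (K \<union> J)) = \<Union>((\<lambda>i. S i - W) ` K) \<union> W"
          by (auto simp: W_def)
        also have "card \<dots> \<le> card (\<Union>((\<lambda>i. S i - W) ` K)) + card W" by (rule card_Un_le)
        finally show ?thesis using J(3) by (simp add: W_def)
      qed
      ultimately obtain g where g: "inj_on g (I - J)" "\<forall>i\<in>I - J. g i \<in> S i - W"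
        using less.hyps[of "I - J" "\<lambda>i. S i - W"] less.prems(1,2) by auto
      define h where "h i = (if i \<in> J then f i else g i)" for i
      have fW: "f i \<in> W" if "i \<in> J" for i using f(2) that by (auto simp: W_def)
      have "inj_on h I"
      proof (rule inj_onI)
        fix x y assume xy: "x \<in> I" "y \<in> I" "h x = h y"
        then show "x = y"
          using fW g f(1) unfolding h_def by (auto split: if_splits dest: inj_onD) (metis DiffD2 DiffI)+
      qed
      moreover have "\<forall>i\<in>I. h i \<in> S i" using f(2) g(2) by (auto simp: h_def)
      ultimately show ?thesis by blast
    next
      case no_tight: False
      obtain a where a: "a \<in> I" using False by blast
      have "card {a} \<le> card (\<Union>(S ` {a}))" using less.prems(3) a by blast
      then obtain x where x: "x \<in> S a" by fastforce
      have "card (I - {a}) < card I" using a less.prems(1) by (meson card_Diff1_less)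
      moreover have "card K \<le> card (\<Union>((\<lambda>i. S i - {x}) ` K))" if K: "K \<subseteq> I - {a}" for K
      proof (cases "K = {}")
        case True
        then show ?thesis by simp
      next
        case False
        \<comment> \<open>Without a tight set, every nonempty proper subfamily has an element to
          spare, so \<open>x\<close> can be reserved for \<open>a\<close>.\<close>
        have "K \<subset> I" using K a by blast
        then have "card K < card (\<Union>(S ` K))"
          using no_tight False less.prems(3)[of K] by (metis le_neq_implies_less psubset_imp_subset)
        moreover have "\<Union>((\<lambda>i. S i - {x}) ` K) = \<Union>(S ` K) - {x}" by auto
        ultimately show ?thesis by (auto simp: card_Diff_singleton_if)
      qed
      ultimately obtain g where g: "inj_on g (I - {a})" "\<forall>i\<in>I - {a}. g i \<in> S i - {x}"
        using less.hyps[of "I - {a}" "\<lambda>i. S i - {x}"] less.prems(1,2) by auto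
      have "inj_on (g(a := x)) I"
        using g by (auto simp: inj_on_def)
      moreover have "\<forall>i\<in>I. (g(a := x)) i \<in> S i" using g(2) x by auto
      ultimately show ?thesis by blast
    qed
  qed
qed

section \<open>Light pairs and counting of hyperedges\<close>

definition color_codegree :: "nat \<Rightarrow> nat \<Rightarrow> (nat set \<Rightarrow> nat) \<Rightarrow> nat \<Rightarrow> nat set \<Rightarrow> nat"
  where "color_codegree r N \<chi> i p = card {e \<in> nsets {..<N} r. \<chi> e = i \<and> p \<subseteq> e}"

definition light_pairs :: "nat \<Rightarrow> nat \<Rightarrow> (nat set \<Rightarrow> nat) \<Rightarrow> nat \<Rightarrow> nat set set"
  where "light_pairs r N \<chi> i = {p \<in> nsets {..<N} 2. color_codegree r N \<chi> i p < r choose 2}"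

text \<open>Double counting yields Hall's condition: each pair in \<open>J\<close> lies in at least
  \<open>r choose 2\<close> hyperedges of color \<open>i\<close>, and a hyperedge contains at most
  that many pairs.\<close>

lemma contains_Berge_heavy:
  assumes r: "2 \<le> r" and A: "A \<in> nsets {..<N} n" and light: "nsets A 2 \<inter> light_pairs r N \<chi> i = {}"
  shows "contains_Berge (color_class (complete_hypergraph r N) \<chi> i) (complete_graph n)"
proof -
  define S where "S p = {e \<in> nsets {..<N} r. \<chi> e = i \<and> p \<subseteq> e}" for p
  let ?t = "r choose 2"
  have AN: "A \<subseteq> {..<N}" "finite A" "card A = n" using A by (auto simp: nsets_def)
  have finS: "finite (S p)" for p by (simp add: S_def finite_imp_finite_nsets)
  have heavy: "?t \<le> card (S p)" if "p \<in> nsets A 2" for p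
  proof -
    have "p \<in> nsets {..<N} 2" using that nsets_mono[OF AN(1)] by blast
    then show ?thesis
      using that light by (auto simp: light_pairs_def color_codegree_def S_def)
  qed
  have "\<exists>f. inj_on f (nsets A 2) \<and> (\<forall>p\<in>nsets A 2. f p \<in> S p)"
  proof (rule Hall_marriage)
    show "finite (nsets A 2)" using AN(2) by (rule finite_imp_finite_nsets)
    fix J assume J: "J \<subseteq> nsets A 2"
    have finJ: "finite J" using J AN(2) finite_imp_finite_nsets finite_subset by blast
    let ?U = "\<Union>(S ` J)"
    have finU: "finite ?U" using finJ finS by blast
    have le: "card {p \<in> J. p \<subseteq> e} \<le> ?t" if "e \<in> ?U" for e
    proof -
      have e: "finite e" "card e = r" using that by (auto simp: S_def nsets_def)
      have "{p \<in> J. p \<subseteq> e} \<subseteq> nsets e 2" using J by (auto simp: nsets_def)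
      then have "card {p \<in> J. p \<subseteq> e} \<le> card (nsets e 2)"
        by (rule card_mono[OF finite_imp_finite_nsets[OF e(1)]])
      then show ?thesis using e by simp
    qed
    have "card J * ?t \<le> (\<Sum>p\<in>J. card (S p))"
      using sum_bounded_below[of J ?t "\<lambda>p. card (S p)"] heavy J by auto
    also have "\<dots> = (\<Sum>p\<in>J. card {e \<in> ?U. p \<subseteq> e})"
      by (rule sum.cong[OF refl], rule arg_cong[of _ _ card]) (auto simp: S_def)
    also have "\<dots> = (\<Sum>e\<in>?U. card {p \<in> J. p \<subseteq> e})"
      by (rule sum_multicount_gen) (use finJ finU in auto)
    also have "\<dots> \<le> card ?U * ?t"
      using sum_bounded_above[of ?U "\<lambda>e. card {p \<in> J. p \<subseteq> e}" ?t] le by auto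
    finally show "card J \<le> card ?U" using r by simp
  qed (rule finS)
  then obtain f where f: "inj_on f (nsets A 2)" "\<forall>p\<in>nsets A 2. f p \<in> S p" by blast
  obtain \<phi> where \<phi>: "bij_betw \<phi> {..<n} A"
    using AN by (metis card_lessThan finite_lessThan finite_same_card_bij)
  have inj: "inj_on \<phi> {..<n}" and img: "\<phi> ` {..<n} = A" using \<phi> by (auto simp: bij_betw_def)
  have pair: "\<phi> ` e \<in> nsets A 2" if "e \<in> nsets {..<n} 2" for e
    using that inj img by (auto simp: nsets_def card_image inj_on_subset)
  have "inj_on (\<lambda>e. f (\<phi> ` e)) (nsets {..<n} 2)"
  proof (rule inj_onI)
    fix d e assume de: "d \<in> nsets {..<n} 2" "e \<in> nsets {..<n} 2" "f (\<phi> ` d) = f (\<phi> ` e)"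
    then have "\<phi> ` d = \<phi> ` e" using f(1) pair by (meson inj_onD)
    moreover have "d \<subseteq> {..<n}" "e \<subseteq> {..<n}" using de by (auto simp: nsets_def)
    ultimately show "d = e" using inj by (simp add: inj_on_image_eq_iff)
  qed
  moreover have "f (\<phi> ` e) \<in> S (\<phi> ` e)" if "e \<in> nsets {..<n} 2" for e
    using f(2) pair[OF that] by blast
  ultimately show ?thesis
    unfolding contains_Berge_def complete_graph_def complete_hypergraph_def color_class_def
    using inj img AN(1)
    by (intro exI[of _ \<phi>] exI[of _ "\<lambda>e. f (\<phi> ` e)"]) (auto simp: S_def)
qed

text \<open>Whatever its color, a hyperedge in \<open>E\<close> contains a listed pair that is light
  in this very color, and such a pair lies in at most \<open>(r choose 2) - 1\<close> hyperedges of
  the color. Both contradictions below come from families \<open>E\<close> exceeding this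
  bound.\<close>

lemma card_rainbow_hyperedges_le:
  assumes E: "E \<subseteq> nsets {..<N} r" and C: "finite C" "\<And>e. e \<in> E \<Longrightarrow> \<chi> e \<in> C"
    and Q: "\<And>i. i \<in> C \<Longrightarrow> finite (Q i)" "\<And>i. i \<in> C \<Longrightarrow> Q i \<subseteq> light_pairs r N \<chi> i"
    and EQ: "\<And>e i. e \<in> E \<Longrightarrow> i \<in> C \<Longrightarrow> \<exists>p\<in>Q i. p \<subseteq> e"
  shows "card E \<le> (\<Sum>i\<in>C. card (Q i)) * ((r choose 2) - 1)"
proof -
  let ?T = "\<lambda>i p. {e \<in> nsets {..<N} r. \<chi> e = i \<and> p \<subseteq> e}"
  have "E \<subseteq> (\<Union>i\<in>C. \<Union>p\<in>Q i. ?T i p)"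
  proof
    fix e assume e: "e \<in> E"
    then obtain p where "p \<in> Q (\<chi> e)" "p \<subseteq> e" using EQ C(2) by blast
    then show "e \<in> (\<Union>i\<in>C. \<Union>p\<in>Q i. ?T i p)" using e E C(2) by auto
  qed
  then have "card E \<le> card (\<Union>i\<in>C. \<Union>p\<in>Q i. ?T i p)"
    by (intro card_mono finite_UN_I C(1) Q(1)) (simp_all add: finite_imp_finite_nsets)
  also have "\<dots> \<le> (\<Sum>i\<in>C. card (\<Union>p\<in>Q i. ?T i p))" by (rule card_UN_le[OF C(1)])
  also have "\<dots> \<le> (\<Sum>i\<in>C. card (Q i) * ((r choose 2) - 1))"
  proof (rule sum_mono)
    fix i assume i: "i \<in> C"
    have "card (?T i p) \<le> (r choose 2) - 1" if "p \<in> Q i" for p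
      using subsetD[OF Q(2)[OF i] that] by (auto simp: light_pairs_def color_codegree_def)
    then have le: "(\<Sum>p\<in>Q i. card (?T i p)) \<le> card (Q i) * ((r choose 2) - 1)"
      using sum_bounded_above[of "Q i" "\<lambda>p. card (?T i p)" "(r choose 2) - 1"] by simp
    have "card (\<Union>p\<in>Q i. ?T i p) \<le> (\<Sum>p\<in>Q i. card (?T i p))" by (rule card_UN_le[OF Q(1)[OF i]])
    also note le
    finally show "card (\<Union>p\<in>Q i. ?T i p) \<le> card (Q i) * ((r choose 2) - 1)" .
  qed
  finally show ?thesis by (simp add: sum_distrib_right)
qed

section \<open>Independent sets from vertices of degree at most one\<close>

definition nbrs :: "'a set set \<Rightarrow> 'a \<Rightarrow> 'a set"
  where "nbrs G v = {u. {u, v} \<in> G}"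

text \<open>All of \<open>I\<close> can be taken. The edges inside \<open>L\<close> form a matching,
  and dropping the larger end of each, collected in \<open>M\<close>, keeps at least half of
  \<open>L\<close>.\<close>

lemma ex_independent_set:
  fixes V :: "'a::linorder set"
  assumes V: "finite V" and G: "G \<subseteq> nsets V 2"
  shows "\<exists>J\<subseteq>V. nsets J 2 \<inter> G = {} \<and>
    2 * card {v \<in> V. nbrs G v = {}} + card {v \<in> V. card (nbrs G v) = 1} \<le> 2 * card J"
proof -
  define I where "I = {v \<in> V. nbrs G v = {}}"
  define L where "L = {v \<in> V. card (nbrs G v) = 1}"
  define M where "M = {v \<in> L. \<exists>u\<in>L. u < v \<and> {u, v} \<in> G}"
  have fin: "finite I" "finite L" "finite M" using V by (auto simp: I_def L_def M_def)
  have IL: "I \<inter> L = {}" "M \<subseteq> L" by (auto simp: I_def L_def M_def)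
  have uniq: "x = y" if v: "v \<in> L" "{x, v} \<in> G" "{y, v} \<in> G" for x y v
  proof -
    obtain z where "nbrs G v = {z}" using v(1) unfolding L_def by (auto simp: card_1_singleton_iff)
    moreover have "x \<in> nbrs G v" "y \<in> nbrs G v" using v by (auto simp: nbrs_def)
    ultimately show ?thesis by simp
  qed
  have "\<forall>v\<in>M. \<exists>u. u \<in> L \<and> u < v \<and> {u, v} \<in> G" by (auto simp: M_def)
  then obtain g where g: "\<And>v. v \<in> M \<Longrightarrow> g v \<in> L \<and> g v < v \<and> {g v, v} \<in> G" by metis
  have "inj_on g M"
  proof (rule inj_onI)
    fix x y assume "x \<in> M" "y \<in> M" "g x = g y"
    then show "x = y" using uniq[of "g x" x y] g[of x] g[of y] by (simp add: insert_commute)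
  qed
  \<comment> \<open>The smaller end of such an edge stays: its only neighbor is the larger end, so
    it is not the larger end of another edge.\<close>
  moreover have "g ` M \<subseteq> L - M"
  proof
    fix y assume "y \<in> g ` M"
    then obtain x where x: "x \<in> M" "y = g x" by blast
    have "y \<notin> M"
    proof
      assume "y \<in> M"
      then have "g y = x"
        using uniq[of y "g y" x] g[of x] g[of y] x by (simp add: insert_commute)
      then show False using g[of x] g[of y] x \<open>y \<in> M\<close> by (auto dest: less_asym)
    qed
    then show "y \<in> L - M" using g x by blast
  qed
  ultimately have "card M \<le> card (L - M)" using fin by (metis card_inj_on_le finite_Diff)
  moreover have "card L = card M + card (L - M)"
    using IL(2) fin by (metis card_Diff_subset card_mono le_add_diff_inverse)
  moreover have "card (I \<union> (L - M)) = card I + card (L - M)"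
    using IL(1) fin by (intro card_Un_disjoint) auto
  moreover have "nsets (I \<union> (L - M)) 2 \<inter> G = {}"
  proof (rule ccontr)
    assume "nsets (I \<union> (L - M)) 2 \<inter> G \<noteq> {}"
    then obtain p where p: "p \<in> nsets (I \<union> (L - M)) 2" "p \<in> G" by blast
    then obtain x y where xy: "p = {x, y}" "x < y" "x \<in> I \<union> (L - M)" "y \<in> I \<union> (L - M)"
      by (smt (verit) insert_commute insert_subset linorder_neqE nsets2_E)
    have "x \<in> nbrs G y" "y \<in> nbrs G x" using p(2) xy(1) by (auto simp: nbrs_def insert_commute)
    then have "x \<in> L - M" "y \<in> L - M" using xy by (auto simp: I_def)
    then show False using xy p(2) by (auto simp: M_def)
  qed
  moreover have "I \<union> (L - M) \<subseteq> V" by (auto simp: I_def L_def)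
  ultimately show ?thesis unfolding I_def[symmetric] L_def[symmetric]
    by (intro exI[of _ "I \<union> (L - M)"]) auto
qed

section \<open>Vertices covered by a choice of pairs\<close>

lemma card_insert_UN_le:
  assumes "finite C"
  shows "card (insert v (\<Union>i\<in>C. T i)) \<le> Suc (\<Sum>i\<in>C. card (T i - {v}))"
proof -
  have "insert v (\<Union>i\<in>C. T i) = insert v (\<Union>i\<in>C. T i - {v})" by auto
  then have "card (insert v (\<Union>i\<in>C. T i)) \<le> Suc (card (\<Union>i\<in>C. T i - {v}))"
    by (metis card_insert_le_m1 diff_Suc_1 order_refl zero_less_Suc)
  also have "\<dots> \<le> Suc (\<Sum>i\<in>C. card (T i - {v}))"
    unfolding Suc_le_mono by (rule card_UN_le[OF assms])
  finally show ?thesis .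
qed

text \<open>Deleting the doubly counted \<open>x\<close> from \<open>T i\<close> keeps the union and
  lowers the sum, which gains one over the general bound. This will make pairs of different colors
  disjoint outside \<open>v\<close>.\<close>

lemma card_insert_UN_overlap_le:
  assumes C: "finite C" "i \<in> C" "j \<in> C" "i \<noteq> j"
    and T: "finite (T i)" "x \<in> T i" "x \<in> T j" "x \<noteq> v"
  shows "card (insert v (\<Union>i\<in>C. T i)) \<le> (\<Sum>i\<in>C. card (T i - {v}))"
proof -
  let ?T = "T(i := T i - {x})"
  have "insert v (\<Union>i\<in>C. T i) = insert v (\<Union>i\<in>C. ?T i)"
    using C T by (auto split: if_splits)
  moreover have "(\<Sum>l\<in>C. card (?T l - {v})) < (\<Sum>l\<in>C. card (T l - {v}))"
  proof (rule sum_strict_mono_ex1[OF C(1)])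
    have lt: "card (?T i - {v}) < card (T i - {v})"
      using T by (intro psubset_card_mono) auto
    then show "\<exists>l\<in>C. card (?T l - {v}) < card (T l - {v})" using C(2) by blast
    show "\<forall>l\<in>C. card (?T l - {v}) \<le> card (T l - {v})"
      using lt by auto
  qed
  ultimately show ?thesis using card_insert_UN_le[OF C(1), of v ?T] by simp
qed

section \<open>The numerical inequality\<close>

lemma double_choose_two: "2 * (r choose 2) = r * (r - 1)"
  unfolding choose_two by (rule dvd_mult_div_cancel) (cases r; simp)

text \<open>This refutes the last count: \<open>2 * c - 1\<close> light pairs carry at most the left
  side, and at least \<open>(r choose 2) + 7 - r\<close> vertices will be free to extend each of
  \<open>2 ^ (c - 1)\<close> sets.\<close>

lemma choose_two_bound:
  assumes "3 \<le> c" "c + 2 \<le> r" "r < 2 * c"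
  shows "(2 * c - 1) * ((r choose 2) - 1) < 2 ^ (c - 1) * ((r choose 2) + 7 - r)"
proof -
  define t where "t = r choose 2"
  have "2 * t = r * (r - 1)" by (simp add: t_def double_choose_two)
  then have "int (2 * t) = int (r * (r - 1))" by simp
  then have t: "2 * int t = int r * int r - int r"
    using assms by (simp add: of_nat_diff algebra_simps)
  \<comment> \<open>This keeps \<open>t + 7 - r\<close> from being truncated. Here and below, a
    nonnegative square gives a linear lower bound on \<open>t\<close>.\<close>
  have r7: "r \<le> t + 1"
    using t zero_le_power2[of "2 * int r - 3"] by (simp add: power2_eq_square algebra_simps)
  \<comment> \<open>Only from \<open>c = 5\<close> on is \<open>2 ^ (c - 1)\<close> at least 3/2
    times \<open>2 * c - 1\<close>; for \<open>c = 3\<close> the claim is just 45 < 48.\<close>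
  consider "c = 3" | "c = 4" | "5 \<le> c" using assms(1) by linarith
  then have "(2 * c - 1) * (t - 1) < 2 ^ (c - 1) * (t + 7 - r)"
  proof cases
    case 1
    then have "r = 5" using assms by simp
    then have "t = 10" using t by simp
    then show ?thesis using 1 \<open>r = 5\<close> by simp
  next
    case 2
    have "8 * int r < int t + 63"
      using t zero_le_power2[of "2 * int r - 17"] by (simp add: power2_eq_square algebra_simps)
    then have "7 * (t - 1) < 8 * (t + 7 - r)" using r7 by linarith
    then show ?thesis using 2 by simp
  next
    case 3
    have "3 * int r < int t + 23"
      using t zero_le_power2[of "2 * int r - 7"] by (simp add: power2_eq_square algebra_simps)
    then have "2 * (t - 1) < 3 * (t + 7 - r)" using r7 by linarith
    then have "(2 * c - 1) * (2 * (t - 1)) < (2 * c - 1) * (3 * (t + 7 - r))"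
      using 3 by (intro mult_strict_left_mono) auto
    moreover have "3 * (2 * c - 1) \<le> 2 * 2 ^ (c - 1)" using 3
    proof (induction c rule: dec_induct)
      case (step m)
      then show ?case by (cases m) auto
    qed simp
    then have "3 * (2 * c - 1) * (t + 7 - r) \<le> 2 * 2 ^ (c - 1) * (t + 7 - r)"
      by (rule mult_le_mono1)
    ultimately show ?thesis by (simp only: mult.assoc mult.left_commute)
  qed
  then show ?thesis by (simp add: t_def)
qed

section \<open>Colorings without a monochromatic Berge copy\<close>

locale berge_free_coloring =
  fixes c r n k N :: nat and \<chi> :: "nat set \<Rightarrow> nat"
  assumes r_eq: "r = c + k + 1" and k_pos: "0 < k" and c_ge: "k + 2 \<le> c"
    and N_gt: "c * (n - 1) < N * k" and N_ge: "(r choose 2) + r + 3 \<le> N" "n + 2 \<le> N"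
    and coloring: "\<And>e. e \<in> nsets {..<N} r \<Longrightarrow> \<chi> e \<in> {1..c}"
    and no_independent: "\<And>i A. i \<in> {1..c} \<Longrightarrow> A \<in> nsets {..<N} n \<Longrightarrow>
      nsets A 2 \<inter> light_pairs r N \<chi> i \<noteq> {}"
begin

abbreviation X :: "nat \<Rightarrow> nat set set"
  where "X i \<equiv> light_pairs r N \<chi> i"

lemma X_subset: "X i \<subseteq> nsets {..<N} 2"
  by (auto simp: light_pairs_def)

lemma finite_X: "finite (X i)"
  using X_subset finite_imp_finite_nsets[of "{..<N}"] finite_subset by blast

lemma card_independent_less:
  assumes "i \<in> {1..c}" "J \<subseteq> {..<N}" "nsets J 2 \<inter> X i = {}"
  shows "card J < n"
proof (rule ccontr)
  assume "\<not> card J < n"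
  then obtain A where A: "A \<subseteq> J" "card A = n" "finite A"
    by (meson not_less obtain_subset_with_card_n)
  then have "A \<in> nsets {..<N} n" using assms(2) by (auto simp: nsets_def)
  then show False using no_independent[OF assms(1)] nsets_mono[OF A(1), of 2] assms(3) by blast
qed

lemma ex_vertex:
  "\<exists>v<N. 2 * card {i \<in> {1..c}. nbrs (X i) v = {}} + card {i \<in> {1..c}. card (nbrs (X i) v) = 1} < 2 * k"
proof (rule ccontr)
  let ?z = "\<lambda>v. card {i \<in> {1..c}. nbrs (X i) v = {}}"
  let ?o = "\<lambda>v. card {i \<in> {1..c}. card (nbrs (X i) v) = 1}"
  assume "\<not> ?thesis"
  then have "2 * k \<le> 2 * ?z v + ?o v" if "v < N" for v using that not_less by blast
  then have "(\<Sum>v<N. 2 * k) \<le> (\<Sum>v<N. 2 * ?z v + ?o v)" by (intro sum_mono) simp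
  also have "\<dots> = 2 * (\<Sum>v<N. ?z v) + (\<Sum>v<N. ?o v)" by (simp add: sum.distrib sum_distrib_left)
  \<comment> \<open>Exchanging summations turns counts of colors at a vertex into counts of vertices
    for a color, where independent sets have at most \<open>n - 1\<close> elements.\<close>
  also have "(\<Sum>v<N. ?z v) = (\<Sum>i\<in>{1..c}. card {v \<in> {..<N}. nbrs (X i) v = {}})"
    by (rule sum_multicount_gen) auto
  also have "(\<Sum>v<N. ?o v) = (\<Sum>i\<in>{1..c}. card {v \<in> {..<N}. card (nbrs (X i) v) = 1})"
    by (rule sum_multicount_gen) auto
  also have "2 * (\<Sum>i\<in>{1..c}. card {v \<in> {..<N}. nbrs (X i) v = {}})
      + (\<Sum>i\<in>{1..c}. card {v \<in> {..<N}. card (nbrs (X i) v) = 1})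
    = (\<Sum>i\<in>{1..c}. 2 * card {v \<in> {..<N}. nbrs (X i) v = {}}
        + card {v \<in> {..<N}. card (nbrs (X i) v) = 1})"
    by (simp only: sum.distrib sum_distrib_left)
  also have "\<dots> \<le> (\<Sum>i\<in>{1..c}. 2 * (n - 1))"
  proof (rule sum_mono)
    fix i assume i: "i \<in> {1..c}"
    obtain J where J: "J \<subseteq> {..<N}" "nsets J 2 \<inter> X i = {}"
      "2 * card {v \<in> {..<N}. nbrs (X i) v = {}} + card {v \<in> {..<N}. card (nbrs (X i) v) = 1} \<le> 2 * card J"
      using ex_independent_set[OF finite_lessThan X_subset] by blast
    then show "2 * card {v \<in> {..<N}. nbrs (X i) v = {}} + card {v \<in> {..<N}. card (nbrs (X i) v) = 1}
        \<le> 2 * (n - 1)"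
      using card_independent_less[OF i J(1,2)] by linarith
  qed
  finally show False using N_gt by simp
qed

text \<open>A smaller \<open>U\<close> would extend to an \<open>(r - 2)\<close>-set
  \<open>W\<close>. Every hyperedge containing \<open>W\<close> would then contain one of
  \<open>c\<close> chosen pairs, light in its own color, but the number of these hyperedges is
  quadratic in \<open>N - (r - 2)\<close>.\<close>

lemma no_small_rainbow:
  assumes U: "U \<subseteq> {..<N}" and rainbow: "\<And>i. i \<in> {1..c} \<Longrightarrow> \<exists>p\<in>X i. p \<subseteq> U"
  shows "r - 1 \<le> card U"
proof (rule ccontr)
  assume "\<not> r - 1 \<le> card U"
  then have "card U \<le> r - 2" by simp
  moreover have "r - 2 \<le> card {..<N}" using N_ge by simp
  ultimately obtain W where W: "U \<subseteq> W" "W \<subseteq> {..<N}" "card W = r - 2"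
    using exists_subset_between[of U "r - 2" "{..<N}"] U by auto
  have finW: "finite W" using W(2) finite_subset by blast
  from rainbow obtain p where p: "\<And>i. i \<in> {1..c} \<Longrightarrow> p i \<in> X i \<and> p i \<subseteq> U" by metis
  let ?M = "nsets ({..<N} - W) 2"
  let ?t = "r choose 2"
  have "inj_on (\<lambda>q. W \<union> q) ?M" by (auto simp: inj_on_def nsets_def)
  then have "card ((\<lambda>q. W \<union> q) ` ?M) = (N - (r - 2)) choose 2"
    using W(2,3) finW by (simp add: card_image card_Diff_subset)
  moreover have "card ((\<lambda>q. W \<union> q) ` ?M) \<le> (\<Sum>i\<in>{1..c}. card {p i}) * (?t - 1)"
  proof (rule card_rainbow_hyperedges_le)
    show "(\<lambda>q. W \<union> q) ` ?M \<subseteq> nsets {..<N} r"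
    proof
      fix e assume "e \<in> (\<lambda>q. W \<union> q) ` ?M"
      then obtain q where q: "e = W \<union> q" "q \<subseteq> {..<N} - W" "finite q" "card q = 2"
        by (auto simp: nsets_def)
      then have "W \<inter> q = {}" by blast
      then have "card e = r" using q finW W(3) r_eq k_pos by (simp add: card_Un_disjoint)
      then show "e \<in> nsets {..<N} r" using q W(2) finW by (auto simp: nsets_def)
    qed
    then show "\<And>e. e \<in> (\<lambda>q. W \<union> q) ` ?M \<Longrightarrow> \<chi> e \<in> {1..c}" using coloring by blast
    show "\<And>e i. e \<in> (\<lambda>q. W \<union> q) ` ?M \<Longrightarrow> i \<in> {1..c} \<Longrightarrow> \<exists>p\<in>{p i}. p \<subseteq> e"
      using p W(1) by blast
  qed (use p in auto)
  ultimately have le: "(N - (r - 2)) choose 2 \<le> c * (?t - 1)" by simp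
  define m where "m = N - (r - 2)"
  have m: "?t + 5 \<le> m" using N_ge r_eq k_pos by (simp add: m_def)
  \<comment> \<open>Since \<open>r \<ge> 5\<close>, \<open>2 * c\<close> is at most
    \<open>?t\<close>, hence at most \<open>m - 1\<close>; this makes \<open>m choose 2\<close>
    exceed \<open>c * (?t - 1)\<close>.\<close>
  have "4 * c \<le> 2 * ?t"
  proof -
    have "4 * c \<le> r * 4" using r_eq by simp
    also have "\<dots> \<le> r * (r - 1)" using r_eq k_pos c_ge by (intro mult_le_mono2) simp
    also have "\<dots> = 2 * ?t" by (simp add: double_choose_two)
    finally show ?thesis .
  qed
  then have "2 * c \<le> m - 1" using m by simp
  then have "2 * (c * (?t - 1)) \<le> (m - 1) * (?t - 1)"
    by (metis mult.assoc mult_le_mono1)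
  also have "\<dots> < (m - 1) * m" using m by (intro mult_strict_left_mono) auto
  also have "\<dots> = 2 * (m choose 2)" by (simp add: double_choose_two mult.commute)
  finally show False using le by (simp add: m_def)
qed

section \<open>The count around a vertex with few poor colors\<close>

lemma inconsistent: False
proof -
  define C where "C = {1..c}"
  have C: "finite C" "card C = c" "C \<noteq> {}" using c_ge by (auto simp: C_def)
  obtain v where vN: "v < N"
    and v: "2 * card {i \<in> C. nbrs (X i) v = {}} + card {i \<in> C. card (nbrs (X i) v) = 1} < 2 * k"
    using ex_vertex unfolding C_def by blast
  define Z where "Z = {i \<in> C. nbrs (X i) v = {}}"
  define L where "L = {i \<in> C. card (nbrs (X i) v) = 1}"
  \<comment> \<open>\<open>s i\<close> is the number of vertices besides \<open>v\<close> that a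
    chosen pair of color \<open>i\<close> uses.\<close>
  define s where "s i = (if i \<in> Z then 2 else 1 :: nat)" for i
  have Z: "Z \<subseteq> C" by (auto simp: Z_def)
  have sum_s: "sum s C = c + card Z"
  proof -
    have "sum s C = (\<Sum>i\<in>C. 1) + (\<Sum>i\<in>C. if i \<in> Z then 1 else 0)"
      by (subst sum.distrib[symmetric], rule sum.cong) (auto simp: s_def)
    also have "\<dots> = c + card (C \<inter> Z)" using C by (simp add: sum.If_cases)
    finally show ?thesis using Z by (simp add: Int_absorb1)
  qed
  \<comment> \<open>A color in \<open>Z\<close> has no light pair at \<open>v\<close>, so any of its light pairs costs two vertices
    besides \<open>v\<close>; every other color is served by a leaf of a star centred at \<open>v\<close>.\<close>
  define opts where "opts i = {p \<in> X i. v \<in> p \<or> i \<in> Z}" for i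
  have opts_X: "opts i \<subseteq> X i" for i by (auto simp: opts_def)
  have opts_pair: "p \<subseteq> {..<N}" "finite p" "card p = 2" if "p \<in> opts i" for p i
    using that X_subset[of i] by (auto simp: opts_def nsets_def)
  have opts_v: "v \<in> p \<longleftrightarrow> i \<notin> Z" if "p \<in> opts i" "i \<in> C" for p i
  proof (cases "i \<in> Z")
    case True
    have "nbrs (X i) v = {}" using True by (simp add: Z_def)
    have "v \<notin> p"
    proof
      assume "v \<in> p"
      with opts_pair(3)[OF that(1)] obtain u where "p = {u, v}"
        by (metis card_2_iff insert_commute insertE singletonD)
      then have "u \<in> nbrs (X i) v" using that(1) opts_X[of i] by (auto simp: nbrs_def)
      then show False using \<open>nbrs (X i) v = {}\<close> by simp
    qed
    then show ?thesis using True by simp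
  next
    case False
    then show ?thesis using that by (simp add: opts_def)
  qed
  have opts_s: "card (p - {v}) = s i" if "p \<in> opts i" "i \<in> C" for p i
    using opts_pair[OF that(1)] opts_v[OF that] by (auto simp: s_def card_Diff_singleton_if)
  have star: "(\<lambda>u. {u, v}) ` nbrs (X i) v \<subseteq> opts i" for i
    by (auto simp: opts_def nbrs_def)
  have fin_nbrs: "finite (nbrs (X i) v)" for i
  proof -
    have "nbrs (X i) v \<subseteq> {..<N}" using X_subset[of i] by (auto simp: nbrs_def)
    then show ?thesis using finite_subset by blast
  qed
  have card_star: "card ((\<lambda>u. {u, v}) ` nbrs (X i) v) = card (nbrs (X i) v)" for i
    by (rule card_image) (auto simp: inj_on_def doubleton_eq_iff)
  have fin_O: "finite (opts i)" for i using opts_X finite_X finite_subset by blast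
  have two: "2 \<le> card (opts i)" if i: "i \<in> C" "i \<notin> L" for i
  proof (cases "i \<in> Z")
    case False
    then have "card (nbrs (X i) v) \<noteq> 0" "card (nbrs (X i) v) \<noteq> 1"
      using i fin_nbrs[of i] by (auto simp: Z_def L_def)
    then have "2 \<le> card (nbrs (X i) v)" by linarith
    also have "\<dots> \<le> card (opts i)" using card_mono[OF fin_O star] card_star by metis
    finally show ?thesis .
  next
    case True
    then have opts: "opts i = X i" by (auto simp: opts_def)
    show ?thesis
    proof (rule ccontr)
      assume "\<not> 2 \<le> card (opts i)"
      then have "card (X i) \<le> 1" using opts by simp
      then have "X i = {} \<or> (\<exists>p. X i = {p})"
        using finite_X[of i] by (metis card_0_eq card_1_singletonE le_Suc_eq le_zero_eq One_nat_def)
      then obtain p where p: "X i \<subseteq> {p}" by blast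
      \<comment> \<open>Removing a vertex of the only possible light pair leaves
        \<open>N - 1 \<ge> n\<close> independent vertices. If \<open>p = {}\<close>, then
        \<open>x\<close> is arbitrary and there is no light pair at all.\<close>
      define x where "x = (SOME x. x \<in> p)"
      have "nsets ({..<N} - {x}) 2 \<inter> X i = {}"
      proof (rule ccontr)
        assume "nsets ({..<N} - {x}) 2 \<inter> X i \<noteq> {}"
        then have "p \<in> nsets ({..<N} - {x}) 2" using p by blast
        then have "p \<noteq> {}" "x \<notin> p" by (auto simp: nsets_def)
        then show False unfolding x_def by (metis some_in_eq)
      qed
      then have "card ({..<N} - {x}) < n"
        using card_independent_less[of i "{..<N} - {x}"] i(1) by (auto simp: C_def)
      then show False using N_ge by (auto simp: card_Diff_singleton_if split: if_splits)
    qed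
  qed
  have opts_ne: "opts i \<noteq> {}" if i: "i \<in> C" for i
  proof (cases "i \<in> L")
    case True
    then have "nbrs (X i) v \<noteq> {}" by (auto simp: L_def)
    then show ?thesis using star by blast
  next
    case False
    then show ?thesis using two[OF i] by auto
  qed
  define U where "U h = insert v (\<Union>i\<in>C. h i)" for h :: "nat \<Rightarrow> nat set"
  have U_sub: "U h \<subseteq> {..<N}" if "\<And>i. i \<in> C \<Longrightarrow> h i \<in> opts i" for h
    using that opts_pair(1) vN unfolding U_def by blast
  have U_ge: "r - 1 \<le> card (U h)" if "\<And>i. i \<in> C \<Longrightarrow> h i \<in> opts i" for h
  proof (rule no_small_rainbow[OF U_sub[OF that]])
    fix i assume "i \<in> {1..c}"
    then have i: "i \<in> C" by (simp add: C_def)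
    then show "\<exists>p\<in>X i. p \<subseteq> U h" using that[OF i] opts_X by (auto simp: U_def)
  qed
  have sum_card: "(\<Sum>i\<in>C. card (h i - {v})) = c + card Z" if "\<And>i. i \<in> C \<Longrightarrow> h i \<in> opts i" for h
    using that opts_s sum_s by (metis (mono_tags, lifting) sum.cong)
  have U_le: "card (U h) \<le> Suc (c + card Z)" if "\<And>i. i \<in> C \<Longrightarrow> h i \<in> opts i" for h
    using card_insert_UN_le[OF C(1), of v h] sum_card[OF that] by (simp add: U_def)
  have "\<forall>i\<in>C. \<exists>p. p \<in> opts i" using opts_ne by blast
  then obtain h0 where h0: "\<And>i. i \<in> C \<Longrightarrow> h0 i \<in> opts i" by metis
  \<comment> \<open>The bounds meet: \<open>r - 1 = c + k\<close> gives
    \<open>k - 1 \<le> card Z\<close>, while the choice of \<open>v\<close> gives the converse and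
    then \<open>card L \<le> 1\<close>.\<close>
  have "r - 1 \<le> Suc (c + card Z)" using U_ge[OF h0] U_le[OF h0] by linarith
  then have card_Z: "card Z = k - 1" and "card L \<le> 1"
    using v r_eq k_pos by (auto simp: Z_def L_def)
  \<comment> \<open>\<open>i0\<close> is the color granted a single option; if \<open>L\<close> is
    empty, any color serves.\<close>
  then obtain i0 where i0: "i0 \<in> C" "L \<subseteq> {i0}"
  proof -
    have "finite L" "L \<subseteq> C" using C(1) by (auto simp: L_def)
    then have "\<exists>i0\<in>C. L \<subseteq> {i0}"
      using \<open>card L \<le> 1\<close> C(3)
      by (metis One_nat_def card_1_singletonE card_eq_0_iff empty_subsetI ex_in_conv insert_subset le_Suc_eq le_zero_eq order_refl)
    then show ?thesis using that by blast
  qed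
  have "\<exists>q. q \<subseteq> opts i \<and> card q = (if i = i0 then 1 else 2)" if i: "i \<in> C" for i
  proof -
    have "(if i = i0 then 1 else 2) \<le> card (opts i)"
      using two[OF i] opts_ne[OF i] fin_O[of i] i0(2) by (auto simp: Suc_le_eq card_gt_0_iff)
    then show ?thesis using obtain_subset_with_card_n by metis
  qed
  then obtain Q where Q: "\<And>i. i \<in> C \<Longrightarrow> Q i \<subseteq> opts i"
      "\<And>i. i \<in> C \<Longrightarrow> card (Q i) = (if i = i0 then 1 else 2)" by metis
  have fin_Q: "finite (Q i)" if "i \<in> C" for i using Q(1)[OF that] fin_O finite_subset by blast
  define H where "H = Pi\<^sub>E C Q"
  have HO: "h i \<in> opts i" if "h \<in> H" "i \<in> C" for h i using that Q(1) by (auto simp: H_def)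
  have "card H = (\<Prod>i\<in>C. card (Q i))" unfolding H_def by (rule card_PiE[OF C(1)])
  also have "\<dots> = (\<Prod>i\<in>C - {i0}. 2) * 1"
    using C(1) i0(1) Q(2) by (simp add: prod.remove)
  finally have card_H: "card H = 2 ^ (c - 1)" using C i0(1) by simp
  have sum_Q: "(\<Sum>i\<in>C. card (Q i)) = 2 * c - 1"
  proof -
    have "(\<Sum>i\<in>C. card (Q i)) = 1 + (\<Sum>i\<in>C - {i0}. 2)"
      using C(1) i0(1) Q(2) by (simp add: sum.remove)
    then show ?thesis using C i0(1) c_ge by simp
  qed
  \<comment> \<open>A common vertex other than \<open>v\<close> would leave \<open>U h\<close> with
    fewer than \<open>r - 1\<close> vertices.\<close>
  have disj: "x = v" if ij: "i \<in> C" "j \<in> C" "i \<noteq> j" and pq: "p \<in> opts i" "q \<in> opts j" "x \<in> p" "x \<in> q"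
    for i j p q x
  proof (rule ccontr)
    assume "x \<noteq> v"
    define h where "h = h0(i := p, j := q)"
    have h: "h l \<in> opts l" if "l \<in> C" for l using h0 that pq by (auto simp: h_def)
    have "card (U h) \<le> c + card Z"
      using card_insert_UN_overlap_le[OF C(1) ij, of h x v] pq ij opts_pair(2)[OF pq(1)] \<open>x \<noteq> v\<close> sum_card[OF h]
      by (simp add: U_def h_def)
    then show False using U_ge[OF h] card_Z r_eq k_pos by linarith
  qed
  have card_U: "card (U h) = r - 1" if "h \<in> H" for h
    using U_ge[OF HO[OF that]] U_le[OF HO[OF that]] card_Z r_eq k_pos by linarith
  have fin_U: "finite (U h)" if "h \<in> H" for h
    using U_sub[OF HO[OF that]] finite_subset by blast
  \<comment> \<open>\<open>U h\<close> determines \<open>h\<close>: a vertex other than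
    \<open>v\<close> belongs to options of one color only, and whether \<open>v\<close> lies in an
    option depends on the color alone.\<close>
  have inj_U: "h i \<subseteq> h' i" if "h \<in> H" "h' \<in> H" "U h = U h'" "i \<in> C" for h h' i
  proof
    fix x assume x: "x \<in> h i"
    show "x \<in> h' i"
    proof (cases "x = v")
      case True
      then show ?thesis using x opts_v HO that by metis
    next
      case False
      have "x \<in> U h'" using x that(3,4) by (auto simp: U_def)
      then obtain j where "j \<in> C" "x \<in> h' j" using False by (auto simp: U_def)
      then show ?thesis using disj[of i j "h i" "h' j" x] x False HO that by metis
    qed
  qed
  define V where "V = insert v (\<Union>i\<in>C. \<Union>(Q i))"
  have card_V: "card V \<le> 2 * r - 4"
  proof -
    have "card (\<Union>(Q i) - {v}) \<le> card (Q i) * s i" if i: "i \<in> C" for i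
    proof -
      have "\<Union>(Q i) - {v} = (\<Union>p\<in>Q i. p - {v})" by auto
      then have "card (\<Union>(Q i) - {v}) \<le> (\<Sum>p\<in>Q i. card (p - {v}))"
        using card_UN_le[OF fin_Q[OF i]] by metis
      also have "\<dots> = (\<Sum>p\<in>Q i. s i)" using opts_s Q(1) i by (intro sum.cong) auto
      finally show ?thesis by simp
    qed
    then have "(\<Sum>i\<in>C. card (\<Union>(Q i) - {v})) \<le> (\<Sum>i\<in>C. card (Q i) * s i)" by (rule sum_mono)
    \<comment> \<open>Every color has two options except \<open>i0\<close>, so with \<open>v\<close>
      there are at most \<open>2 * (c + k - 1) - 1 + 1 = 2 * r - 4\<close> vertices.\<close>
    moreover have "(\<Sum>i\<in>C. card (Q i) * s i) + s i0 = 2 * sum s C"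
      using C(1) i0(1) Q(2) by (simp add: sum.remove sum_distrib_left)
    moreover have "1 \<le> s i0" by (simp add: s_def)
    moreover have "card V \<le> Suc (\<Sum>i\<in>C. card (\<Union>(Q i) - {v}))"
      unfolding V_def by (rule card_insert_UN_le[OF C(1)])
    ultimately show ?thesis using sum_s card_Z r_eq k_pos by linarith
  qed
  have UV: "U h \<subseteq> V" if "h \<in> H" for h
    using that by (auto simp: U_def V_def H_def)
  have VN: "V \<subseteq> {..<N}" using vN Q(1) opts_pair(1) by (fastforce simp: V_def)
  let ?B = "H \<times> ({..<N} - V)"
  let ?e = "\<lambda>(h, w). insert w (U h)"
  have inj: "inj_on ?e ?B"
  proof (rule inj_onI, clarify)
    fix h w h' w' assume hw: "h \<in> H" "h' \<in> H" "w \<notin> V" "w' \<notin> V" "insert w (U h) = insert w' (U h')"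
    \<comment> \<open>As \<open>w\<close> lies outside \<open>V\<close> and \<open>U h\<close>
      inside, intersecting with \<open>V\<close> recovers \<open>U h\<close>.\<close>
    then have "insert w (U h) \<inter> V = insert w' (U h') \<inter> V" by simp
    then have UU: "U h = U h'" using hw UV by (metis Int_absorb2 Int_insert_left_if0)
    then have "h = h'"
      using hw(1,2) inj_U[OF hw(1,2) UU] inj_U[OF hw(2,1) UU[symmetric]]
      unfolding H_def by (intro PiE_ext[of h C Q h']) (simp_all add: subset_antisym)
    moreover have "w = w'" using hw(1-4) UV hw(5)[unfolded UU] by (metis insert_ident insertE insertI1 subsetD)
    ultimately show "h = h' \<and> w = w'" by simp
  qed
  have "card (?e ` ?B) = 2 ^ (c - 1) * (N - card V)"
    using VN by (simp add: card_image[OF inj] card_cartesian_product card_H card_Diff_subset finite_subset)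
  moreover have "card (?e ` ?B) \<le> (\<Sum>i\<in>C. card (Q i)) * ((r choose 2) - 1)"
  proof (rule card_rainbow_hyperedges_le)
    show sub: "?e ` ?B \<subseteq> nsets {..<N} r"
    proof (clarify)
      fix h w assume hw: "h \<in> H" "w < N" "w \<notin> V"
      have "w \<notin> U h" using hw UV by blast
      then have "card (insert w (U h)) = r" using card_U[OF hw(1)] fin_U[OF hw(1)] r_eq by simp
      then show "insert w (U h) \<in> nsets {..<N} r"
        using hw U_sub[OF HO[OF hw(1)]] fin_U[OF hw(1)] by (auto simp: nsets_def)
    qed
    show "\<And>e. e \<in> ?e ` ?B \<Longrightarrow> \<chi> e \<in> C" using sub coloring unfolding C_def by blast
    show "\<exists>p\<in>Q i. p \<subseteq> e" if e: "e \<in> ?e ` ?B" and i: "i \<in> C" for e i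
    proof -
      obtain h w where h: "h \<in> H" "e = insert w (U h)" using e by auto
      then have "h i \<in> Q i" "h i \<subseteq> e" using i by (auto simp: H_def U_def)
      then show ?thesis by blast
    qed
    show "Q i \<subseteq> X i" if "i \<in> C" for i using Q(1)[OF that] opts_X by (rule subset_trans)
  qed (simp_all add: C(1) fin_Q)
  ultimately have "2 ^ (c - 1) * (N - card V) \<le> (2 * c - 1) * ((r choose 2) - 1)"
    using sum_Q by simp
  \<comment> \<open>This is \<open>(r choose 2) + r + 3\<close>, the lower bound on
    \<open>N\<close>, minus \<open>2 * r - 4\<close>.\<close>
  moreover have "(r choose 2) + 7 - r \<le> N - card V" using card_V N_ge r_eq k_pos c_ge by linarith
  then have "2 ^ (c - 1) * ((r choose 2) + 7 - r) \<le> 2 ^ (c - 1) * (N - card V)" by simp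
  ultimately have "2 ^ (c - 1) * ((r choose 2) + 7 - r) \<le> (2 * c - 1) * ((r choose 2) - 1)"
    by (rule le_trans[rotated])
  moreover have "(2 * c - 1) * ((r choose 2) - 1) < 2 ^ (c - 1) * ((r choose 2) + 7 - r)"
    by (rule choose_two_bound) (use r_eq k_pos c_ge in simp_all)
  ultimately show False by simp
qed

end

section \<open>From the contradiction to the Ramsey bound\<close>

theorem theorem3:
  fixes c r n :: nat
  assumes "0 < c" and "0 < r"
    and "c + 1 < r" and "r < 2 * c"
    and "real n > (real r - real c - 1) / real c * real (r choose 2) + real r - 1"
  shows "real (berge_ramsey c r (complete_graph n)) \<le> real c / (real r - real c - 1) * real n"
proof -
  define k where "k = r - c - 1"
  \<comment> \<open>The integer part of the claimed bound.\<close>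
  define N where "N = c * n div k"
  let ?t = "r choose 2"
  have r_eq: "r = c + k + 1" and k: "0 < k" and c: "k + 2 \<le> c"
    using assms(3,4) by (auto simp: k_def)
  have rk: "real r - real c - 1 = real k" using r_eq by simp
  have "real k * real ?t + real c * (real r - 1) < real c * real n"
    using assms(1,5) unfolding rk by (simp add: field_simps)
  then have "real (k * ?t + c * (c + k)) < real (c * n)" using r_eq by simp
  then have n: "k * ?t + c * (c + k) < c * n" by (simp only: of_nat_less_iff)
  have N: "N * k \<le> c * n" "c * n < (N + 1) * k"
    using k by (simp_all add: N_def dividend_less_div_times)
  have "c * (c + k) < c * n" using n by linarith
  then have "c + k < n" using assms(1) by simp
  have "forces_Berge c r (complete_graph n) N"
    unfolding forces_Berge_def
  proof (intro allI impI, rule ccontr)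
    fix \<chi> assume col: "is_coloring c (complete_hypergraph r N) \<chi>"
      and no: "\<not> (\<exists>i\<in>{1..c}. contains_Berge (color_class (complete_hypergraph r N) \<chi> i) (complete_graph n))"
    interpret berge_free_coloring c r n k N \<chi>
    proof (rule berge_free_coloring.intro)
      show "c * (n - 1) < N * k"
      proof -
        have "c * (n - 1) + c = c * n" using \<open>c + k < n\<close> by (cases n) simp_all
        \<comment> \<open>Rounding down costs less than \<open>k\<close>, which is below the
          \<open>c\<close> gained from \<open>n - 1\<close>.\<close>
        then show ?thesis using N(2) c by simp
      qed
      have "k * (?t + r + 3) < k * (N + 1)"
      proof -
        obtain d where "c = k + 2 + d" using c le_Suc_ex by blast
        \<comment> \<open>So the term \<open>c * (c + k)\<close>, which comes from
          \<open>r - 1\<close> in the hypothesis on \<open>n\<close>, pays for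
          \<open>r + 3\<close>.\<close>
        then have "k * (r + 3) \<le> c * (c + k)" using r_eq by (simp add: algebra_simps)
        then show ?thesis using n N(2) by (simp add: algebra_simps)
      qed
      then have "?t + r + 3 < N + 1" unfolding mult_less_cancel1 by (rule conjunct2)
      then show "?t + r + 3 \<le> N" by simp
      have "k * (n + 2) \<le> c * n"
      proof -
        have "k * (n + 2) \<le> (k + 2) * n" using \<open>c + k < n\<close> by (simp add: algebra_simps)
        also have "\<dots> \<le> c * n" by (rule mult_le_mono1[OF c])
        finally show ?thesis .
      qed
      then have "k * (n + 2) < k * (N + 1)" using N(2) by (simp add: mult.commute)
      then have "n + 2 < N + 1" unfolding mult_less_cancel1 by (rule conjunct2)
      then show "n + 2 \<le> N" by simp
      show "\<chi> e \<in> {1..c}" if "e \<in> nsets {..<N} r" for e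
        using that col unfolding is_coloring_def complete_hypergraph_def by auto
      \<comment> \<open>The contrapositive of \<open>contains_Berge_heavy\<close>.\<close>
      show "nsets A 2 \<inter> light_pairs r N \<chi> i \<noteq> {}" if "i \<in> {1..c}" "A \<in> nsets {..<N} n" for i A
        using contains_Berge_heavy[OF _ that(2), of r \<chi> i] no that(1) r_eq k c by auto
    qed (rule r_eq k c)+
    show False by (rule inconsistent)
  qed
  then have "berge_ramsey c r (complete_graph n) \<le> N"
    unfolding berge_ramsey_def by (rule Least_le)
  then have "berge_ramsey c r (complete_graph n) * k \<le> c * n"
    using N(1) by (meson le_trans mult_le_mono1)
  then have "real (berge_ramsey c r (complete_graph n)) * real k \<le> real c * real n"
    by (metis of_nat_le_iff of_nat_mult)
  then show ?thesis unfolding rk using k by (simp add: field_simps)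
qed

end
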